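(* Let $X$ be a Tychonoff space and let $E$ be any set of functions with $L(X)\subseteq E\subseteq C(X_{\aleph_0})$, endowed with the topology of pointwise convergence. Then $nw(E)=nw(X_{\aleph_0})$.
   Context: All spaces are Tychonoff. A zero-set of $X$ is a set $\{x\in X: f(x)=0\}$ with $f:X\to\mathbb{R}$ continuous; $Z(X)$ is the family of all zero-sets of $X$. $X_{\aleph_0}$ is the set $X$ with the (Baire) topology having $Z(X)$ as a base. $C(X_{\aleph_0})$ is the set of all continuous real-valued functions on $X_{\aleph_0}$. $L(X)=\{n_1 f_{Z_1}+\dots+n_k f_{Z_k}: k\in\mathbb{N},\ n_i\in\mathbb{N},\ Z_i\in Z(X)\}$, where $f_Z$ is the characteristic function of $Z\subseteq X$. The topology of pointwise convergence on $E$ is the subspace topology from $\mathbb{R}^X$. $nw(Y)$ is the network weight of $Y$. As is standard, values of cardinal functions are taken to be infinite cardinals (at least $\omega_0$). *)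

theory Defs
  imports "HOL-Analysis.Analysis"
begin

unbundle cardinal_syntax

definition Tychonoff_space :: "'a topology \<Rightarrow> bool" where
  "Tychonoff_space X \<longleftrightarrow> completely_regular_space X \<and> Hausdorff_space X"

definition zero_sets :: "'a topology \<Rightarrow> 'a set set" where
  "zero_sets X = {{x \<in> topspace X. f x = 0} | f. continuous_map X euclideanreal f}"

definition Baire_topology :: "'a topology \<Rightarrow> 'a topology" where
  "Baire_topology X = topology (arbitrary union_of (\<lambda>Z. Z \<in> zero_sets X))"

(* Real-valued functions on the carrier of a space are represented by functions
   extensional on it, i.e. by the points of the library's power powertop_real (topspace X). *)

definition real_continuous_functions :: "'a topology \<Rightarrow> ('a \<Rightarrow> real) set" where
  "real_continuous_functions Y =
     {f \<in> extensional (topspace Y). continuous_map Y euclideanreal f}"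

(* Whether k or the coefficients n i may vanish is immaterial: the empty set is a zero-set,
   so the zero function is in any case 1 times the characteristic function of a zero-set. *)

definition zero_set_combinations :: "'a topology \<Rightarrow> ('a \<Rightarrow> real) set" where
  "zero_set_combinations X =
     {(\<lambda>x\<in>topspace X. \<Sum>i=1..k. real (n i) * indicator (Z i) x) | (k::nat) (n::nat \<Rightarrow> nat) Z.
        \<forall>i\<in>{1..k}. Z i \<in> zero_sets X}"

definition pointwise_topology :: "'a set \<Rightarrow> ('a \<Rightarrow> real) set \<Rightarrow> ('a \<Rightarrow> real) topology" where
  "pointwise_topology S E = subtopology (powertop_real S) E"

definition is_network :: "'a topology \<Rightarrow> 'a set set \<Rightarrow> bool" where
  "is_network Y \<N> \<longleftrightarrow> \<N> \<subseteq> Pow (topspace Y) \<and>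
     (\<forall>U x. openin Y U \<and> x \<in> U \<longrightarrow> (\<exists>N\<in>\<N>. x \<in> N \<and> N \<subseteq> U))"

definition is_least_network :: "'a topology \<Rightarrow> 'a set set \<Rightarrow> bool" where
  "is_least_network Y \<N> \<longleftrightarrow> is_network Y \<N> \<and> (\<forall>\<M>. is_network Y \<M> \<longrightarrow> |\<N>| \<le>o |\<M>| )"

(* Cardinals are well-order relations up to =o. Adding natLeq (the cardinal omega) turns a
   finite least cardinality into omega and leaves an infinite one unchanged. *)

definition network_weight :: "'a topology \<Rightarrow> ('a set + nat) rel" where
  "network_weight Y = |SOME \<N>. is_least_network Y \<N>| +c natLeq"

(* Well-definedness: the zero-sets are a base, and a network of least cardinality exists. *)

lemma zero_sets_Int:
  assumes "A \<in> zero_sets X" "B \<in> zero_sets X"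
  shows "A \<inter> B \<in> zero_sets X"
proof -
  obtain f g where f: "continuous_map X euclideanreal f" "A = {x \<in> topspace X. f x = 0}"
    and g: "continuous_map X euclideanreal g" "B = {x \<in> topspace X. g x = 0}"
    using assms unfolding zero_sets_def by blast
  have "continuous_map X euclideanreal (\<lambda>x. \<bar>f x\<bar> + \<bar>g x\<bar>)"
    using f g by (intro continuous_intros) auto
  moreover have "A \<inter> B = {x \<in> topspace X. \<bar>f x\<bar> + \<bar>g x\<bar> = 0}"
    using f g by auto
  ultimately show ?thesis
    unfolding zero_sets_def by (intro CollectI exI conjI)
qed

lemma openin_Baire_topology:
  "openin (Baire_topology X) = arbitrary union_of (\<lambda>Z. Z \<in> zero_sets X)"
  unfolding Baire_topology_def
  by (intro topology_inverse' istopology_base zero_sets_Int)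

lemma topspace_Baire_topology: "topspace (Baire_topology X) = topspace X"
proof
  have "topspace X = {x \<in> topspace X. (\<lambda>_. 0::real) x = 0}" by simp
  moreover have "continuous_map X euclideanreal (\<lambda>_. 0)" by simp
  ultimately have "topspace X \<in> zero_sets X"
    unfolding zero_sets_def by (intro CollectI exI conjI)
  then show "topspace X \<subseteq> topspace (Baire_topology X)"
    by (intro openin_subset) (simp add: openin_Baire_topology union_of_inc arbitrary_def)
  have "(arbitrary union_of (\<lambda>Z. Z \<in> zero_sets X)) (topspace (Baire_topology X))"
    by (metis openin_Baire_topology openin_topspace)
  then obtain \<U> where \<U>: "\<U> \<subseteq> zero_sets X" "\<Union>\<U> = topspace (Baire_topology X)"
    unfolding union_of_def by auto
  have "Z \<subseteq> topspace X" if "Z \<in> zero_sets X" for Z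
    using that unfolding zero_sets_def by auto
  then show "topspace (Baire_topology X) \<subseteq> topspace X"
    using \<U> by (metis Sup_least subsetD)
qed

lemma is_least_network_exists: "\<exists>\<N>. is_least_network Y \<N>"
proof -
  let ?R = "card_of ` {\<N>. is_network Y \<N>}"
  have "is_network Y (Pow (topspace Y))"
    using openin_subset unfolding is_network_def by (metis PowI order_refl)
  then have "?R \<noteq> {}" by blast
  moreover have "\<forall>r \<in> ?R. Card_order r"
    by (simp add: card_of_Card_order)
  ultimately have "\<exists>r \<in> ?R. \<forall>r' \<in> ?R. r \<le>o r'"
    by (rule exists_minim_Card_order)
  then show ?thesis
    by (simp add: is_least_network_def)
qed

end

theory Submission
  imports Defs
begin

text \<open>
  Evaluation pairs \<open>Baire_topology X\<close> with \<open>E\<close>, and each of the two spaces carries the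
  topology that the real functions given by the points of the other one generate. For \<open>E\<close>
  this is the definition of pointwise convergence; for \<open>Baire_topology X\<close> it holds because the
  characteristic functions of the basic open sets, the zero-sets, belong to \<open>E\<close>, while all
  members of \<open>E\<close> are continuous.

  In such a pairing, networks pass from either side to the other
  (\<open>dual_network_exists\<close>): given a network \<open>\<M>\<close> on one side, those points of the
  other side that map \<open>S\<close> into \<open>J\<close>, for finitely many pairs of an \<open>S\<close> in \<open>\<M>\<close> and a basic open
  \<open>J\<close> of the real line, form a network. There are at most \<open>|\<M>| + \<omega>\<close> such finite
  families. Applying this in both directions gives the two inequalities.
\<close>

text \<open>
  The subsets with \<open>n + 1\<close> elements arise by inserting a point into one with \<open>n\<close> elements, so
  by induction there are at most \<open>r \<cdot> r = r\<close> of them, and a countable union of such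
  families does not exceed \<open>r\<close>.
\<close>

lemma card_of_Fpow_le:
  assumes r: "Cinfinite r" and K: "|K| \<le>o r"
  shows "|Fpow K| \<le>o r"
proof -
  have r': "infinite (Field r)" "Card_order r"
    using r by (auto simp: cinfinite_def)
  define F where "F n = {S \<in> Fpow K. card S = n}" for n
  have F: "|F n| \<le>o r" for n
  proof (induction n)
    case 0
    have "F 0 = {{}}" by (auto simp: F_def Fpow_def)
    then have "Cfinite |F 0|"
      by (simp add: cfinite_def Field_card_of card_of_card_order_on)
    then show ?case
      by (rule ordLess_imp_ordLeq[OF Cfinite_ordLess_Cinfinite[OF _ r]])
  next
    case (Suc n)
    have "F (Suc n) \<subseteq> (\<lambda>(x, S). insert x S) ` (K \<times> F n)"
    proof
      fix S assume S: "S \<in> F (Suc n)"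
      then have "card S = Suc n" by (simp add: F_def)
      then obtain x T where "S = insert x T" "x \<notin> T" "card T = n"
        using card_Suc_eq[of S n] by blast
      moreover from this have "x \<in> K" "T \<in> F n"
        using S by (auto simp: F_def Fpow_def)
      ultimately show "S \<in> (\<lambda>(x, S). insert x S) ` (K \<times> F n)" by auto
    qed
    then have "|F (Suc n)| \<le>o |K \<times> F n|"
      by (rule surj_imp_ordLeq)
    also have "|K \<times> F n| \<le>o r"
      using card_of_Times_ordLeq_infinite_Field[OF r'(1) K Suc r'(2)] .
    finally show ?case .
  qed
  have "|UNIV :: nat set| \<le>o r"
    by (rule ordIso_ordLeq_trans[OF card_of_nat natLeq_ordLeq_cinfinite[OF r]])
  then have "|\<Union>n. F n| \<le>o r"
    using F by (intro card_of_UNION_ordLeq_infinite_Field r') auto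
  moreover have "Fpow K = (\<Union>n. F n)"
    by (auto simp: F_def)
  ultimately show ?thesis by simp
qed

text \<open>
  A neighbourhood of \<open>b\<close> contains a set given by finitely many conditions \<open>e a b' \<in> V a\<close>
  on \<open>b'\<close>. Continuity in the first variable allows each point \<open>a\<close> to be enlarged to a member
  \<open>S\<close> of the network of \<open>A\<close> with \<open>e x b \<in> J\<close> for all \<open>x \<in> S\<close>, where \<open>J \<subseteq> V a\<close> is
  taken from a countable base of the line. The condition on \<open>b'\<close> is thereby strengthened to one of
  only \<open>|\<M>| + \<omega>\<close> many, and \<open>b\<close> still satisfies it.
\<close>

lemma dual_network_exists:
  fixes A :: "'a topology" and B :: "'b topology" and e :: "'a \<Rightarrow> 'b \<Rightarrow> real"
  assumes cont: "\<And>b. b \<in> topspace B \<Longrightarrow> continuous_map A euclideanreal (\<lambda>a. e a b)"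
    and gen: "\<And>U b. openin B U \<Longrightarrow> b \<in> U \<Longrightarrow>
      \<exists>F V. finite F \<and> F \<subseteq> topspace A \<and> (\<forall>a\<in>F. open (V a) \<and> e a b \<in> V a) \<and>
        {b' \<in> topspace B. \<forall>a\<in>F. e a b' \<in> V a} \<subseteq> U"
    and net: "is_network A \<M>"
  shows "\<exists>\<N>. is_network B \<N> \<and> |\<N>| \<le>o |\<M>| +c natLeq"
proof -
  obtain \<B> :: "real set set" where \<B>: "countable \<B>" "topological_basis \<B>"
    using ex_countable_basis by blast
  define W where "W P = {b \<in> topspace B. \<forall>(S, J)\<in>P. \<forall>a\<in>S. e a b \<in> J}" for P
  let ?\<N> = "W ` Fpow (\<M> \<times> \<B>)"
  have "is_network B ?\<N>"
    unfolding is_network_def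
  proof (intro conjI allI impI)
    show "?\<N> \<subseteq> Pow (topspace B)" by (auto simp: W_def)
    fix U b assume "openin B U \<and> b \<in> U"
    then have U: "openin B U" "b \<in> U" and b: "b \<in> topspace B"
      using openin_subset by auto
    obtain F V where F: "finite F" "F \<subseteq> topspace A"
      and V: "\<forall>a\<in>F. open (V a) \<and> e a b \<in> V a"
      and sub: "{b' \<in> topspace B. \<forall>a\<in>F. e a b' \<in> V a} \<subseteq> U"
      using gen[OF U] by blast
    have "\<exists>S J. S \<in> \<M> \<and> J \<in> \<B> \<and> a \<in> S \<and> J \<subseteq> V a \<and> (\<forall>x\<in>S. e x b \<in> J)" if a: "a \<in> F" for a
    proof -
      obtain J where J: "J \<in> \<B>" "e a b \<in> J" "J \<subseteq> V a"
        using V a topological_basisE[OF \<B>(2), of "V a" "e a b"] by blast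
      have "openin A {x \<in> topspace A. e x b \<in> J}"
        using openin_continuous_map_preimage[OF cont[OF b]] topological_basis_open[OF \<B>(2) J(1)]
        by simp
      then obtain S where "S \<in> \<M>" "a \<in> S" "S \<subseteq> {x \<in> topspace A. e x b \<in> J}"
        using net J(2) a F(2) unfolding is_network_def by blast
      then show ?thesis using J by blast
    qed
    then obtain S J where SJ: "\<And>a. a \<in> F \<Longrightarrow> S a \<in> \<M> \<and> J a \<in> \<B> \<and> a \<in> S a \<and> J a \<subseteq> V a
        \<and> (\<forall>x\<in>S a. e x b \<in> J a)"
      by metis
    let ?P = "(\<lambda>a. (S a, J a)) ` F"
    have "?P \<in> Fpow (\<M> \<times> \<B>)"
      using SJ F(1) by (auto simp: Fpow_def)
    moreover have "b \<in> W ?P"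
      using b SJ by (auto simp: W_def)
    moreover have "W ?P \<subseteq> U"
      using sub SJ unfolding W_def by fastforce
    ultimately show "\<exists>N\<in>?\<N>. b \<in> N \<and> N \<subseteq> U"
      by (intro bexI[of _ "W ?P"] conjI imageI)
  qed
  \<comment> \<open>Adding \<open>natLeq\<close> covers a finite \<open>\<M>\<close>, for which \<open>\<M> \<times> \<B>\<close> can be infinite.\<close>
  moreover have "|?\<N>| \<le>o |\<M>| +c natLeq"
  proof -
    have r: "Cinfinite ( |\<M>| +c natLeq)"
      by (intro Cinfinite_csum disjI2 natLeq_Cinfinite)
    then have r': "infinite (Field ( |\<M>| +c natLeq))" "Card_order ( |\<M>| +c natLeq)"
      by (auto simp: cinfinite_def)
    have "|\<B>| \<le>o |UNIV :: nat set|"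
      using \<B>(1) card_of_ordLeq[of \<B> "UNIV :: nat set"] unfolding countable_def by auto
    also have "|UNIV :: nat set| =o natLeq"
      by (rule card_of_nat)
    also have "natLeq \<le>o |\<M>| +c natLeq"
      by (rule ordLeq_csum2[OF natLeq_Card_order])
    finally have "|\<B>| \<le>o |\<M>| +c natLeq" .
    moreover have "|\<M>| \<le>o |\<M>| +c natLeq"
      by (rule ordLeq_csum1[OF card_of_Card_order])
    ultimately have "|\<M> \<times> \<B>| \<le>o |\<M>| +c natLeq"
      by (intro card_of_Times_ordLeq_infinite_Field r')
    then have "|Fpow (\<M> \<times> \<B>)| \<le>o |\<M>| +c natLeq"
      by (rule card_of_Fpow_le[OF r])
    then show ?thesis
      by (rule ordLeq_transitive[OF card_of_image])
  qed
  ultimately show ?thesis by blast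
qed

lemma network_weight_le_dual:
  fixes A :: "'a topology" and B :: "'b topology" and e :: "'a \<Rightarrow> 'b \<Rightarrow> real"
  assumes "\<And>b. b \<in> topspace B \<Longrightarrow> continuous_map A euclideanreal (\<lambda>a. e a b)"
    and "\<And>U b. openin B U \<Longrightarrow> b \<in> U \<Longrightarrow>
      \<exists>F V. finite F \<and> F \<subseteq> topspace A \<and> (\<forall>a\<in>F. open (V a) \<and> e a b \<in> V a) \<and>
        {b' \<in> topspace B. \<forall>a\<in>F. e a b' \<in> V a} \<subseteq> U"
  shows "network_weight B \<le>o network_weight A"
proof -
  define \<M> where "\<M> = (SOME \<M>. is_least_network A \<M>)"
  define \<N> where "\<N> = (SOME \<N>. is_least_network B \<N>)"
  have \<M>: "is_least_network A \<M>" and \<N>: "is_least_network B \<N>"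
    unfolding \<M>_def \<N>_def by (rule someI_ex[OF is_least_network_exists])+
  obtain \<N>' where \<N>': "is_network B \<N>'" "|\<N>'| \<le>o |\<M>| +c natLeq"
    using dual_network_exists[OF assms] \<M> unfolding is_least_network_def by blast
  then have "|\<N>| \<le>o |\<N>'|"
    using \<N> unfolding is_least_network_def by blast
  then have "|\<N>| \<le>o |\<M>| +c natLeq"
    using \<N>'(2) by (rule ordLeq_transitive)
  moreover have "natLeq \<le>o |\<M>| +c natLeq"
    by (rule ordLeq_csum2[OF natLeq_Card_order])
  moreover have "Cinfinite ( |\<M>| +c natLeq)"
    by (intro Cinfinite_csum disjI2 natLeq_Cinfinite)
  ultimately have "|\<N>| +c natLeq \<le>o |\<M>| +c natLeq"
    by (intro csum_cinfinite_bound card_of_Card_order natLeq_Card_order)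
  then show ?thesis
    by (simp add: network_weight_def \<M>_def \<N>_def)
qed

lemma topspace_pointwise_topology:
  "E \<subseteq> extensional S \<Longrightarrow> topspace (pointwise_topology S E) = E"
  by (auto simp: pointwise_topology_def PiE_def)

lemma continuous_map_evaluation:
  "x \<in> S \<Longrightarrow> continuous_map (pointwise_topology S E) euclideanreal (\<lambda>f. f x)"
  unfolding pointwise_topology_def
  by (intro continuous_map_from_subtopology continuous_map_product_projection)

lemma pointwise_topology_generated_by_evaluations:
  assumes "openin (pointwise_topology S E) U" "f \<in> U"
  shows "\<exists>F V. finite F \<and> F \<subseteq> S \<and> (\<forall>x\<in>F. open (V x) \<and> f x \<in> V x) \<and>
    {g \<in> topspace (pointwise_topology S E). \<forall>x\<in>F. g x \<in> V x} \<subseteq> U"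
proof -
  obtain T where T: "openin (powertop_real S) T" "U = T \<inter> E"
    using assms(1) unfolding pointwise_topology_def openin_subtopology by blast
  then obtain V where V: "finite {x \<in> S. V x \<noteq> UNIV}" "\<forall>x\<in>S. open (V x)"
      "f \<in> Pi\<^sub>E S V" "Pi\<^sub>E S V \<subseteq> T"
    using assms(2) unfolding openin_product_topology_alt
    by (metis IntD1 open_openin topspace_euclidean)
  have "{g \<in> topspace (pointwise_topology S E). \<forall>x\<in>{x \<in> S. V x \<noteq> UNIV}. g x \<in> V x} \<subseteq> U"
  proof
    fix g assume g: "g \<in> {g \<in> topspace (pointwise_topology S E). \<forall>x\<in>{x \<in> S. V x \<noteq> UNIV}. g x \<in> V x}"
    then have "g \<in> Pi\<^sub>E S V" "g \<in> E"
      by (auto simp: pointwise_topology_def PiE_iff)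
    then show "g \<in> U" using V(4) T(2) by blast
  qed
  moreover have "\<forall>x\<in>{x \<in> S. V x \<noteq> UNIV}. open (V x) \<and> f x \<in> V x"
    using V by (auto simp: PiE_iff)
  ultimately show ?thesis
    using V(1) by (intro exI[of _ "{x \<in> S. V x \<noteq> UNIV}"] exI[of _ V]) auto
qed

lemma restrict_indicator_in_zero_set_combinations:
  assumes "Z \<in> zero_sets X"
  shows "restrict (indicator Z) (topspace X) \<in> zero_set_combinations X"
  unfolding zero_set_combinations_def
proof (intro CollectI exI conjI)
  show "restrict (indicator Z) (topspace X) =
      (\<lambda>x\<in>topspace X. \<Sum>i=1..1. real ((\<lambda>_. 1) i) * indicator ((\<lambda>_::nat. Z) i) x)"
    by simp
  show "\<forall>i\<in>{1..1::nat}. (\<lambda>_::nat. Z) i \<in> zero_sets X"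
    using assms by simp
qed

lemma Baire_topology_zero_set_neighbourhood:
  assumes "openin (Baire_topology X) U" "x \<in> U"
  shows "\<exists>Z\<in>zero_sets X. x \<in> Z \<and> Z \<subseteq> U"
  using assms unfolding openin_Baire_topology arbitrary_union_of_alt by blast

theorem theorem9p2:
  fixes X :: "'a topology" and E :: "('a \<Rightarrow> real) set"
  assumes "Tychonoff_space X"
    and "zero_set_combinations X \<subseteq> E"
    and "E \<subseteq> real_continuous_functions (Baire_topology X)"
  shows "network_weight (pointwise_topology (topspace X) E) =o network_weight (Baire_topology X)"
proof -
  let ?E = "pointwise_topology (topspace X) E"
  have ext: "E \<subseteq> extensional (topspace X)"
    and cont: "\<And>f. f \<in> E \<Longrightarrow> continuous_map (Baire_topology X) euclideanreal f"
    using assms(3) unfolding real_continuous_functions_def topspace_Baire_topology by auto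
  note top = topspace_pointwise_topology[OF ext] topspace_Baire_topology
  have "network_weight ?E \<le>o network_weight (Baire_topology X)"
  proof (rule network_weight_le_dual[where e = "\<lambda>x f. f x"])
    show "continuous_map (Baire_topology X) euclideanreal (\<lambda>x. f x)" if "f \<in> topspace ?E" for f
      using that cont by (simp add: top)
    show "\<exists>F V. finite F \<and> F \<subseteq> topspace (Baire_topology X) \<and> (\<forall>x\<in>F. open (V x) \<and> f x \<in> V x) \<and>
        {g \<in> topspace ?E. \<forall>x\<in>F. g x \<in> V x} \<subseteq> U" if "openin ?E U" "f \<in> U" for U f
      using pointwise_topology_generated_by_evaluations[OF that] by (simp add: top)
  qed
  moreover have "network_weight (Baire_topology X) \<le>o network_weight ?E"
  proof (rule network_weight_le_dual[where e = "\<lambda>f x. f x"])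
    show "continuous_map ?E euclideanreal (\<lambda>f. f x)" if "x \<in> topspace (Baire_topology X)" for x
      using that by (simp add: top continuous_map_evaluation)
    show "\<exists>F V. finite F \<and> F \<subseteq> topspace ?E \<and> (\<forall>f\<in>F. open (V f) \<and> f x \<in> V f) \<and>
        {y \<in> topspace (Baire_topology X). \<forall>f\<in>F. f y \<in> V f} \<subseteq> U"
      if U: "openin (Baire_topology X) U" "x \<in> U" for U x
    proof -
      obtain Z where Z: "Z \<in> zero_sets X" "x \<in> Z" "Z \<subseteq> U"
        using Baire_topology_zero_set_neighbourhood[OF U] by blast
      have x: "x \<in> topspace X"
        using openin_subset[OF U(1)] U(2) by (auto simp: top)
      let ?f = "restrict (indicator Z) (topspace X) :: 'a \<Rightarrow> real"
      have "?f \<in> E"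
        using restrict_indicator_in_zero_set_combinations[OF Z(1)] assms(2) by blast
      moreover have "{y \<in> topspace X. ?f y \<in> {0<..}} \<subseteq> U"
        using Z(3) by (auto simp: indicator_def split: if_splits)
      \<comment> \<open>The characteristic function of \<open>Z\<close> cuts \<open>Z\<close> out by the single condition of being positive.\<close>
      ultimately show ?thesis
        using x Z(2) by (intro exI[of _ "{?f}"] exI[of _ "\<lambda>_. {0<..}"]) (auto simp: top)
    qed
  qed
  ultimately show ?thesis
    by (simp add: ordIso_iff_ordLeq)
qed

end
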